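(* Let $G$ be a group such that (i) $D_{\omega,\mathbb{Q}}(G)\neq\{1\}$ and (ii) $D_\omega(G)=\{1\}$. Let $g_1,g_2,\ldots,g_n$ be any finitely many distinct elements of $G$, and let $W$ be the subgroup of $G$ generated by the left-normed commutators $[w_1,w_2,\ldots,w_r]$, $r\geq 1$, such that $w_i\in\{g_j^{-1}g_k : 1\leq j,k\leq n,\ j\neq k\}$ for $1\leq i\leq r$, and such that for every $1\leq j,k\leq n$ with $j\neq k$, either $g_j^{-1}g_k$ or $g_k^{-1}g_j$ equals some $w_i$. Then one of the following holds: (a) the subgroup $W$ is contained in $C_G(D_{\omega,\mathbb{Q}}(G))$, the centralizer of $D_{\omega,\mathbb{Q}}(G)$ in $G$; (b) $g_1,g_2,\ldots,g_n$ are discriminated by the class $\mathcal{K}:=\bigcup_{p\ \mathrm{prime}}\mathcal{K}_p$, where $\mathcal{K}_p$ denotes the class of nilpotent $p$-groups of bounded exponent.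
   Context: For a group $G$, $\Delta(G)$ is the augmentation ideal of the integral group ring $\mathbb{Z}G$ and $\Delta_{\mathbb{Q}}(G)$ is the augmentation ideal of the rational group algebra $\mathbb{Q}G$; superscripts $n$ denote ideal powers. $D_n(G)=G\cap(1+\Delta^n(G))$, $D_\omega(G)=\bigcap_{n=1}^\infty D_n(G)$, $D_{n,\mathbb{Q}}(G)=G\cap(1+\Delta_{\mathbb{Q}}^n(G))$, and $D_{\omega,\mathbb{Q}}(G)=\bigcap_{n=1}^\infty D_{n,\mathbb{Q}}(G)$. Commutators are $[x,y]=x^{-1}y^{-1}xy$; left-normed commutators are defined by $[w_1]=w_1$ and $[w_1,\ldots,w_r]=[[w_1,\ldots,w_{r-1}],w_r]$ for $r\ge2$. Distinct elements $g_1,\ldots,g_n$ of $G$ are discriminated by a class $\mathcal{K}$ of groups if there exist a group $H\in\mathcal{K}$ and a homomorphism $\varphi:G\to H$ such that $\varphi(g_i)\ne\varphi(g_j)$ for $i\neq j$. *)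

theory Defs
  imports "HOL-Algebra.Algebra" "HOL-Library.Poly_Mapping"
begin

section \<open>Group rings and the augmentation ideal\<close>

text \<open>
  The group ring of \<open>G\<close> with coefficients in the type \<open>'r\<close> consists of the finitely supported
  functions whose support lies in \<open>carrier G\<close>; a group element \<open>a\<close> corresponds to
  \<open>Poly_Mapping.single a 1\<close>. The multiplication that \<open>'a \<Rightarrow>\<^sub>0 'r\<close> carries as a type
  is not used, since it requires a type class monoid \<open>'a\<close>.
\<close>

definition group_ring :: "('a, 'b) monoid_scheme \<Rightarrow> ('a \<Rightarrow>\<^sub>0 'r::comm_ring_1) ring" where
  "group_ring G =
     \<lparr> carrier = {f. Poly_Mapping.keys f \<subseteq> carrier G},
       monoid.mult = (\<lambda>f h. \<Sum>a\<in>Poly_Mapping.keys f. \<Sum>b\<in>Poly_Mapping.keys h.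
                 Poly_Mapping.single (a \<otimes>\<^bsub>G\<^esub> b) (Poly_Mapping.lookup f a * Poly_Mapping.lookup h b)),
       one = Poly_Mapping.single \<one>\<^bsub>G\<^esub> 1,
       ring.zero = 0,
       ring.add = (+) \<rparr>"

definition augmentation :: "('a \<Rightarrow>\<^sub>0 'r::comm_ring_1) \<Rightarrow> 'r" where
  "augmentation f = (\<Sum>a\<in>Poly_Mapping.keys f. Poly_Mapping.lookup f a)"

definition augmentation_ideal :: "('a, 'b) monoid_scheme \<Rightarrow> ('a \<Rightarrow>\<^sub>0 'r::comm_ring_1) set" where
  "augmentation_ideal G = {f \<in> carrier (group_ring G). augmentation f = 0}"

lemma keys_single_subset: "Poly_Mapping.keys (Poly_Mapping.single a r) \<subseteq> {a}"
  by simp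

lemma group_ring_mult_superset:
  assumes "finite S" "finite T" "Poly_Mapping.keys f \<subseteq> S" "Poly_Mapping.keys h \<subseteq> T"
  shows "f \<otimes>\<^bsub>group_ring G\<^esub> h = (\<Sum>a\<in>S. \<Sum>b\<in>T.
           Poly_Mapping.single (a \<otimes>\<^bsub>G\<^esub> b) (Poly_Mapping.lookup f a * Poly_Mapping.lookup h b))"
proof -
  have "f \<otimes>\<^bsub>group_ring G\<^esub> h = (\<Sum>a\<in>Poly_Mapping.keys f. \<Sum>b\<in>T.
           Poly_Mapping.single (a \<otimes>\<^bsub>G\<^esub> b) (Poly_Mapping.lookup f a * Poly_Mapping.lookup h b))"
    unfolding group_ring_def monoid.simps using assms
    by (intro sum.cong[OF refl] sum.mono_neutral_left) (auto simp: in_keys_iff)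
  also have "\<dots> = (\<Sum>a\<in>S. \<Sum>b\<in>T.
           Poly_Mapping.single (a \<otimes>\<^bsub>G\<^esub> b) (Poly_Mapping.lookup f a * Poly_Mapping.lookup h b))"
    using assms by (intro sum.mono_neutral_left) (auto simp: in_keys_iff)
  finally show ?thesis .
qed

lemma group_ring_mult_add_left:
  "(f + f') \<otimes>\<^bsub>group_ring G\<^esub> h = f \<otimes>\<^bsub>group_ring G\<^esub> h + f' \<otimes>\<^bsub>group_ring G\<^esub> h"
proof -
  let ?S = "Poly_Mapping.keys f \<union> Poly_Mapping.keys f'" and ?T = "Poly_Mapping.keys h"
  note E = group_ring_mult_superset[where S = ?S and T = ?T and h = h and G = G]
  show ?thesis
    using Poly_Mapping.keys_add[of f f']
    by (simp add: E lookup_add distrib_right single_add sum.distrib)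
qed

lemma group_ring_mult_add_right:
  "h \<otimes>\<^bsub>group_ring G\<^esub> (f + f') = h \<otimes>\<^bsub>group_ring G\<^esub> f + h \<otimes>\<^bsub>group_ring G\<^esub> f'"
proof -
  let ?S = "Poly_Mapping.keys f \<union> Poly_Mapping.keys f'" and ?T = "Poly_Mapping.keys h"
  note E = group_ring_mult_superset[where S = ?T and T = ?S and f = h and G = G]
  show ?thesis
    using Poly_Mapping.keys_add[of f f']
    by (simp add: E lookup_add distrib_left single_add sum.distrib)
qed

lemma group_ring_mult_single_single:
  "Poly_Mapping.single a r \<otimes>\<^bsub>group_ring G\<^esub> Poly_Mapping.single b s =
     Poly_Mapping.single (a \<otimes>\<^bsub>G\<^esub> b) (r * s)"
  by (subst group_ring_mult_superset[where S = "{a}" and T = "{b}"]) auto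

lemma group_ring_mult_zero_left: "0 \<otimes>\<^bsub>group_ring G\<^esub> h = 0"
  by (simp add: group_ring_def)

lemma group_ring_mult_zero_right: "h \<otimes>\<^bsub>group_ring G\<^esub> 0 = 0"
  by (simp add: group_ring_def)

lemma poly_mapping_single_add_induct [consumes 1, case_names zero single add]:
  fixes f :: "'a \<Rightarrow>\<^sub>0 'r::comm_ring_1"
  assumes S: "Poly_Mapping.keys f \<subseteq> S"
    and zero: "P 0"
    and single: "\<And>a r. a \<in> S \<Longrightarrow> P (Poly_Mapping.single a r)"
    and add: "\<And>f h. P f \<Longrightarrow> P h \<Longrightarrow> P (f + h)"
  shows "P f"
proof -
  have "P (\<Sum>a\<in>A. Poly_Mapping.single a (Poly_Mapping.lookup f a))"
    if "finite A" "A \<subseteq> S" for A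
    using that by (induction A) (auto intro: zero single add)
  from this[OF _ S] have "P (\<Sum>a\<in>Poly_Mapping.keys f. Poly_Mapping.single a (Poly_Mapping.lookup f a))"
    by simp
  moreover have "(\<Sum>a\<in>Poly_Mapping.keys f. Poly_Mapping.single a (Poly_Mapping.lookup f a)) = f"
    by (rule poly_mapping_eqI) (auto simp: lookup_sum lookup_single when_def in_keys_iff)
  ultimately show ?thesis by simp
qed

lemma ring_group_ring:
  assumes "group G"
  shows "ring (group_ring G :: ('a \<Rightarrow>\<^sub>0 'r::comm_ring_1) ring)"
proof -
  interpret G: group G by fact
  let ?R = "group_ring G :: ('a \<Rightarrow>\<^sub>0 'r::comm_ring_1) ring"
  have carrier: "f \<in> carrier ?R \<longleftrightarrow> Poly_Mapping.keys f \<subseteq> carrier G" for f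
    by (simp add: group_ring_def)
  have add: "f \<oplus>\<^bsub>?R\<^esub> h = f + h" and zero: "\<zero>\<^bsub>?R\<^esub> = 0"
    and one: "\<one>\<^bsub>?R\<^esub> = Poly_Mapping.single \<one>\<^bsub>G\<^esub> 1" for f h
    by (simp_all add: group_ring_def)
  have add_closed: "f + h \<in> carrier ?R" if "f \<in> carrier ?R" "h \<in> carrier ?R" for f h
    using that Poly_Mapping.keys_add[of f h] by (auto simp: carrier)
  have mult_closed: "f \<otimes>\<^bsub>?R\<^esub> h \<in> carrier ?R"
    if f: "f \<in> carrier ?R" and h: "h \<in> carrier ?R" for f h
    using f[unfolded carrier]
  proof (induction rule: poly_mapping_single_add_induct)
    case (single a r)
    show ?case using h[unfolded carrier]
    proof (induction rule: poly_mapping_single_add_induct)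
      case (single b s)
      with \<open>a \<in> carrier G\<close> show ?case
        using keys_single_subset[of "a \<otimes>\<^bsub>G\<^esub> b" "r * s"]
        by (auto simp: group_ring_mult_single_single carrier)
    qed (auto simp: group_ring_mult_zero_right group_ring_mult_add_right add_closed carrier[of 0])
  qed (auto simp: group_ring_mult_zero_left group_ring_mult_add_left add_closed carrier[of 0])
  have assoc: "(f \<otimes>\<^bsub>?R\<^esub> h) \<otimes>\<^bsub>?R\<^esub> k = f \<otimes>\<^bsub>?R\<^esub> (h \<otimes>\<^bsub>?R\<^esub> k)"
    if f: "f \<in> carrier ?R" and h: "h \<in> carrier ?R" and k: "k \<in> carrier ?R" for f h k
    using f[unfolded carrier]
  proof (induction rule: poly_mapping_single_add_induct)
    case (single a r)
    show ?case using h[unfolded carrier]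
    proof (induction rule: poly_mapping_single_add_induct)
      case (single b s)
      show ?case using k[unfolded carrier]
      proof (induction rule: poly_mapping_single_add_induct)
        case (single c t)
        with \<open>a \<in> carrier G\<close> \<open>b \<in> carrier G\<close> show ?case
          by (simp add: group_ring_mult_single_single G.m_assoc mult.assoc)
      qed (auto simp: group_ring_mult_zero_right group_ring_mult_add_right)
    qed (auto simp: group_ring_mult_zero_right group_ring_mult_zero_left
           group_ring_mult_add_right group_ring_mult_add_left)
  qed (auto simp: group_ring_mult_zero_left group_ring_mult_add_left)
  have one_left: "\<one>\<^bsub>?R\<^esub> \<otimes>\<^bsub>?R\<^esub> f = f" and one_right: "f \<otimes>\<^bsub>?R\<^esub> \<one>\<^bsub>?R\<^esub> = f"
    if f: "f \<in> carrier ?R" for f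
    using f[unfolded carrier] unfolding one
    by (induction rule: poly_mapping_single_add_induct;
        simp add: group_ring_mult_single_single group_ring_mult_zero_left
          group_ring_mult_zero_right group_ring_mult_add_left group_ring_mult_add_right)+
  show ?thesis
  proof (rule ringI)
    show "abelian_group ?R"
    proof (rule abelian_groupI)
      fix f assume "f \<in> carrier ?R"
      then show "\<exists>h\<in>carrier ?R. h \<oplus>\<^bsub>?R\<^esub> f = \<zero>\<^bsub>?R\<^esub>"
        by (intro bexI[of _ "- f"]) (auto simp: add zero carrier in_keys_iff)
    qed (auto simp: add zero add_closed carrier[of 0] ac_simps)
    show "monoid ?R"
      by (rule monoidI) (auto simp: mult_closed assoc one_left one_right, auto simp: one carrier)
  qed (auto simp: add group_ring_mult_add_left group_ring_mult_add_right)
qed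

lemma augmentation_superset:
  assumes "finite S" "Poly_Mapping.keys f \<subseteq> S"
  shows "augmentation f = (\<Sum>a\<in>S. Poly_Mapping.lookup f a)"
  unfolding augmentation_def using assms by (intro sum.mono_neutral_left) (auto simp: in_keys_iff)

lemma augmentation_add: "augmentation (f + h) = augmentation f + augmentation h"
proof -
  let ?S = "Poly_Mapping.keys f \<union> Poly_Mapping.keys h"
  show ?thesis
    using Poly_Mapping.keys_add[of f h]
    by (simp add: augmentation_superset[where S = ?S] lookup_add sum.distrib)
qed

lemma augmentation_single [simp]: "augmentation (Poly_Mapping.single a r) = r"
  by (simp add: augmentation_superset[where S = "{a}"])

lemma augmentation_zero [simp]: "augmentation 0 = 0"
  by (simp add: augmentation_def)

lemma augmentation_mult:
  "augmentation (f \<otimes>\<^bsub>group_ring G\<^esub> h) = augmentation f * augmentation h"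
  using subset_UNIV[of "Poly_Mapping.keys f"]
proof (induction f rule: poly_mapping_single_add_induct)
  case (single a r)
  show ?case
    using subset_UNIV[of "Poly_Mapping.keys h"]
    by (induction h rule: poly_mapping_single_add_induct)
      (auto simp: group_ring_mult_single_single group_ring_mult_zero_right
         group_ring_mult_add_right augmentation_add distrib_left)
qed (auto simp: group_ring_mult_zero_left group_ring_mult_add_left augmentation_add distrib_right)

lemma ideal_augmentation_ideal:
  assumes "group G"
  shows "ideal (augmentation_ideal G :: ('a \<Rightarrow>\<^sub>0 'r::comm_ring_1) set) (group_ring G)"
proof -
  let ?R = "group_ring G :: ('a \<Rightarrow>\<^sub>0 'r::comm_ring_1) ring"
  interpret R: ring ?R by (rule ring_group_ring[OF assms])
  have add: "f \<oplus>\<^bsub>?R\<^esub> h = f + h" and zero: "\<zero>\<^bsub>?R\<^esub> = 0" for f h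
    by (simp_all add: group_ring_def)
  have neg: "augmentation (\<ominus>\<^bsub>?R\<^esub> f) = 0" if "f \<in> carrier ?R" "augmentation f = 0" for f
    using that R.r_neg[of f] augmentation_add[of f "\<ominus>\<^bsub>?R\<^esub> f"] by (simp add: add zero)
  show ?thesis
  proof (rule idealI)
    show "subgroup (augmentation_ideal G) (add_monoid ?R)"
      by (rule R.add.subgroupI)
         (use R.zero_closed in \<open>auto simp: augmentation_ideal_def add zero augmentation_add neg
            R.a_inv_closed simp flip: a_inv_def intro: R.a_closed[unfolded add]\<close>)
  qed (auto simp: augmentation_ideal_def augmentation_mult R.ring_axioms)
qed


section \<open>Dimension subgroups\<close>

text \<open>The first argument is the type of coefficients. The power is taken in the multiplicative
  structure \<^const>\<open>ideals_set\<close>, whose multiplication is the product of ideals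
  \<^const>\<open>ideal_prod\<close>.\<close>

definition dimension_subgroup ::
    "'r::comm_ring_1 itself \<Rightarrow> ('a, 'b) monoid_scheme \<Rightarrow> nat \<Rightarrow> 'a set" where
  "dimension_subgroup _ G n =
     {x \<in> carrier G. Poly_Mapping.single x (1 :: 'r) \<in>
        \<one>\<^bsub>group_ring G\<^esub> <+\<^bsub>group_ring G\<^esub> (augmentation_ideal G [^]\<^bsub>ideals_set (group_ring G)\<^esub> n)}"

definition dimension_subgroup_omega ::
    "'r::comm_ring_1 itself \<Rightarrow> ('a, 'b) monoid_scheme \<Rightarrow> 'a set" where
  "dimension_subgroup_omega r G = (\<Inter>n\<in>{1..}. dimension_subgroup r G n)"


section \<open>Commutators\<close>

definition group_commutator :: "('a, 'b) monoid_scheme \<Rightarrow> 'a \<Rightarrow> 'a \<Rightarrow> 'a" where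
  "group_commutator G x y = inv\<^bsub>G\<^esub> x \<otimes>\<^bsub>G\<^esub> inv\<^bsub>G\<^esub> y \<otimes>\<^bsub>G\<^esub> x \<otimes>\<^bsub>G\<^esub> y"

text \<open>Only meaningful for nonempty lists.\<close>

definition left_normed_commutator :: "('a, 'b) monoid_scheme \<Rightarrow> 'a list \<Rightarrow> 'a" where
  "left_normed_commutator G ws = foldl (group_commutator G) (hd ws) (tl ws)"

lemma left_normed_commutator_singleton: "left_normed_commutator G [w] = w"
  by (simp add: left_normed_commutator_def)

lemma left_normed_commutator_snoc:
  assumes "ws \<noteq> []"
  shows "left_normed_commutator G (ws @ [w]) =
           group_commutator G (left_normed_commutator G ws) w"
  using assms by (simp add: left_normed_commutator_def)

definition difference_commutator_subgroup ::
    "('a, 'b) monoid_scheme \<Rightarrow> (nat \<Rightarrow> 'a) \<Rightarrow> nat \<Rightarrow> 'a set" where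
  "difference_commutator_subgroup G g n =
     generate G {left_normed_commutator G ws | ws.
       ws \<noteq> [] \<and>
       set ws \<subseteq> {inv\<^bsub>G\<^esub> (g j) \<otimes>\<^bsub>G\<^esub> g k | j k. j \<in> {1..n} \<and> k \<in> {1..n} \<and> j \<noteq> k} \<and>
       (\<forall>j\<in>{1..n}. \<forall>k\<in>{1..n}. j \<noteq> k \<longrightarrow>
          inv\<^bsub>G\<^esub> (g j) \<otimes>\<^bsub>G\<^esub> g k \<in> set ws \<or> inv\<^bsub>G\<^esub> (g k) \<otimes>\<^bsub>G\<^esub> g j \<in> set ws)}"

definition group_centralizer :: "('a, 'b) monoid_scheme \<Rightarrow> 'a set \<Rightarrow> 'a set" where
  "group_centralizer G S = {x \<in> carrier G. \<forall>s\<in>S. x \<otimes>\<^bsub>G\<^esub> s = s \<otimes>\<^bsub>G\<^esub> x}"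


section \<open>Nilpotent p-groups of bounded exponent\<close>

text \<open>The index is shifted by one against the usual convention: index 0 is the whole group.\<close>

primrec lower_central_series :: "('a, 'b) monoid_scheme \<Rightarrow> nat \<Rightarrow> 'a set" where
  "lower_central_series G 0 = carrier G"
| "lower_central_series G (Suc i) =
     generate G {group_commutator G x y | x y. x \<in> lower_central_series G i \<and> y \<in> carrier G}"

definition nilpotent_group :: "('a, 'b) monoid_scheme \<Rightarrow> bool" where
  "nilpotent_group G \<longleftrightarrow> group G \<and> (\<exists>c. lower_central_series G c = {\<one>\<^bsub>G\<^esub>})"

text \<open>Elements of infinite order have \<^const>\<open>group.ord\<close> equal to 0, which is not a power
  of a prime.\<close>

definition p_group :: "nat \<Rightarrow> ('a, 'b) monoid_scheme \<Rightarrow> bool" where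
  "p_group p G \<longleftrightarrow> group G \<and> (\<forall>x\<in>carrier G. \<exists>k. group.ord G x = p ^ k)"

definition bounded_exponent :: "('a, 'b) monoid_scheme \<Rightarrow> bool" where
  "bounded_exponent G \<longleftrightarrow> (\<exists>m::nat. m > 0 \<and> (\<forall>x\<in>carrier G. x [^]\<^bsub>G\<^esub> m = \<one>\<^bsub>G\<^esub>))"

definition nilpotent_p_group_bounded :: "nat \<Rightarrow> ('a, 'b) monoid_scheme \<Rightarrow> bool" where
  "nilpotent_p_group_bounded p G \<longleftrightarrow> nilpotent_group G \<and> p_group p G \<and> bounded_exponent G"

definition in_class_K :: "('a, 'b) monoid_scheme \<Rightarrow> bool" where
  "in_class_K G \<longleftrightarrow> (\<exists>p. Factorial_Ring.prime p \<and> nilpotent_p_group_bounded p G)"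


section \<open>Discrimination\<close>

definition discriminated_by ::
    "('c monoid \<Rightarrow> bool) \<Rightarrow> ('a, 'b) monoid_scheme \<Rightarrow> (nat \<Rightarrow> 'a) \<Rightarrow> nat \<Rightarrow> bool" where
  "discriminated_by K G g n \<longleftrightarrow>
     (\<exists>H \<phi>. group H \<and> K H \<and> \<phi> \<in> hom G H \<and>
        (\<forall>i\<in>{1..n}. \<forall>j\<in>{1..n}. i \<noteq> j \<longrightarrow> \<phi> (g i) \<noteq> \<phi> (g j)))"

text \<open>
  HOL cannot quantify over the element type of \<open>H\<close>, so it is a parameter of the definition.
  The lemma \<open>discriminated_by_class_K_factor\<close> below shows that for the class at hand it suffices
  to consider groups on the type \<open>'a set\<close>, the type of quotients of \<open>G\<close>.
\<close>

lemma lower_central_series_subset: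
  assumes "group G"
  shows "lower_central_series G i \<subseteq> carrier G"
proof (induction i)
  case (Suc i)
  interpret group G by fact
  have "{group_commutator G x y | x y. x \<in> lower_central_series G i \<and> y \<in> carrier G} \<subseteq> carrier G"
    using Suc by (auto simp: group_commutator_def)
  from generate_incl[OF this] show ?case by simp
qed simp

lemma one_in_lower_central_series:
  assumes "group G"
  shows "\<one>\<^bsub>G\<^esub> \<in> lower_central_series G i"
proof -
  interpret group G by fact
  show ?thesis by (cases i) (auto intro: generate.one)
qed

lemma lower_central_series_hom:
  assumes "group_hom G H h"
  shows "h ` lower_central_series G i \<subseteq> lower_central_series H i"
proof (induction i)
  case 0
  interpret group_hom G H h by fact
  show ?case by auto
next
  case (Suc i)
  interpret group_hom G H h by fact
  let ?A = "{group_commutator G x y | x y. x \<in> lower_central_series G i \<and> y \<in> carrier G}"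
  let ?B = "{group_commutator H x y | x y. x \<in> lower_central_series H i \<and> y \<in> carrier H}"
  note sub = lower_central_series_subset[OF G.is_group, of i]
  have A: "?A \<subseteq> carrier G"
    using sub by (auto simp: group_commutator_def)
  have "h ` ?A \<subseteq> ?B"
  proof
    fix z assume "z \<in> h ` ?A"
    then obtain x y where xy: "x \<in> lower_central_series G i" "y \<in> carrier G"
      and z: "z = h (group_commutator G x y)" by auto
    have "x \<in> carrier G" using xy sub by auto
    then have "z = group_commutator H (h x) (h y)"
      using xy z by (simp add: group_commutator_def)
    moreover have "h x \<in> lower_central_series H i" using Suc xy by auto
    ultimately show "z \<in> ?B" using xy(2) hom_closed by blast
  qed
  then have "generate H (h ` ?A) \<subseteq> generate H ?B"
    by (rule H.mono_generate)
  then show ?case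
    using generate_img[OF A] by simp
qed

lemma in_class_K_inj_hom:
  assumes h: "group_hom G H h" and inj: "inj_on h (carrier G)" and K: "in_class_K H"
  shows "in_class_K G"
proof -
  interpret group_hom G H h by fact
  from K obtain p where p: "Factorial_Ring.prime p" and Kp: "nilpotent_p_group_bounded p H"
    by (auto simp: in_class_K_def)
  have one_iff: "h x = \<one>\<^bsub>H\<^esub> \<longleftrightarrow> x = \<one>\<^bsub>G\<^esub>" if "x \<in> carrier G" for x
    using inj_onD[OF inj, of x "\<one>\<^bsub>G\<^esub>"] that by auto
  obtain c where c: "lower_central_series H c = {\<one>\<^bsub>H\<^esub>}"
    using Kp by (auto simp: nilpotent_p_group_bounded_def nilpotent_group_def)
  have "lower_central_series G c \<subseteq> {\<one>\<^bsub>G\<^esub>}"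
    using lower_central_series_hom[OF h, of c] lower_central_series_subset[OF G.is_group, of c]
      one_iff by (auto simp: c)
  with one_in_lower_central_series[OF G.is_group, of c]
  have nil: "nilpotent_group G"
    by (auto simp: nilpotent_group_def intro!: exI[of _ c])
  have pow_iff: "h x [^]\<^bsub>H\<^esub> m = \<one>\<^bsub>H\<^esub> \<longleftrightarrow> x [^]\<^bsub>G\<^esub> m = \<one>\<^bsub>G\<^esub>" if "x \<in> carrier G" for x and m :: nat
    using one_iff[of "x [^]\<^bsub>G\<^esub> m"] that by (simp add: hom_nat_pow)
  have ord: "H.ord (h x) = G.ord x" if "x \<in> carrier G" for x
  proof (rule H.ord_unique[THEN iffD2])
    show "h x \<in> carrier H" using that by simp
    show "\<forall>m. h x [^]\<^bsub>H\<^esub> m = \<one>\<^bsub>H\<^esub> \<longleftrightarrow> G.ord x dvd m"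
      unfolding pow_iff[OF that] G.pow_eq_id[OF that] by simp
  qed
  have "\<exists>k. G.ord x = p ^ k" if "x \<in> carrier G" for x
    using Kp hom_closed[OF that] unfolding nilpotent_p_group_bounded_def p_group_def ord[OF that, symmetric]
    by blast
  then have "p_group p G"
    using G.is_group by (simp add: p_group_def)
  moreover obtain m :: nat where "m > 0" "\<And>y. y \<in> carrier H \<Longrightarrow> y [^]\<^bsub>H\<^esub> m = \<one>\<^bsub>H\<^esub>"
    using Kp unfolding nilpotent_p_group_bounded_def bounded_exponent_def by blast
  then have "bounded_exponent G"
    unfolding bounded_exponent_def using pow_iff hom_closed by blast
  ultimately show ?thesis
    using nil p by (auto simp: in_class_K_def nilpotent_p_group_bounded_def)
qed

lemma discriminated_by_class_K_factor:
  fixes G :: "('a, 'b) monoid_scheme"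
  assumes G: "group G" and g: "g \<in> {1..n} \<rightarrow> carrier G"
    and disc: "discriminated_by (in_class_K :: 'c monoid \<Rightarrow> bool) G g n"
  shows "discriminated_by (in_class_K :: 'a set monoid \<Rightarrow> bool) G g n"
proof -
  from disc obtain H :: "'c monoid" and \<phi> where H: "group H" and K: "in_class_K H"
    and hom: "\<phi> \<in> hom G H"
    and ne: "\<forall>i\<in>{1..n}. \<forall>j\<in>{1..n}. i \<noteq> j \<longrightarrow> \<phi> (g i) \<noteq> \<phi> (g j)"
    unfolding discriminated_by_def by blast
  interpret group_hom G H \<phi>
    using G H hom by (simp add: group_hom_def group_hom_axioms_def)
  let ?N = "kernel G H \<phi>" and ?f = "\<lambda>A. the_elem (\<phi> ` A)"
  let ?Q = "G Mod ?N"
  interpret N: normal ?N G by (rule normal_kernel)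
  have Q: "group ?Q" by (rule N.factorgroup_is_group)
  have "group_hom ?Q H ?f"
    using Q H FactGroup_hom by (simp add: group_hom_def group_hom_axioms_def)
  then have "in_class_K ?Q"
    using in_class_K_inj_hom FactGroup_inj_on K by blast
  moreover have "(\<lambda>a. ?N #>\<^bsub>G\<^esub> a) \<in> hom G ?Q"
    by (rule N.r_coset_hom_Mod)
  moreover have "?N #>\<^bsub>G\<^esub> g i \<noteq> ?N #>\<^bsub>G\<^esub> g j"
    if ij: "i \<in> {1..n}" "j \<in> {1..n}" "i \<noteq> j" for i j
  proof
    assume eq: "?N #>\<^bsub>G\<^esub> g i = ?N #>\<^bsub>G\<^esub> g j"
    have c: "g i \<in> carrier G" "g j \<in> carrier G" using g ij by auto
    have "g i \<in> ?N #>\<^bsub>G\<^esub> g j"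
      using eq G.rcos_self[OF c(1) N.is_subgroup] by simp
    then obtain k where k: "k \<in> carrier G" "\<phi> k = \<one>\<^bsub>H\<^esub>" "g i = k \<otimes>\<^bsub>G\<^esub> g j"
      unfolding r_coset_def kernel_def by blast
    have "\<phi> (g i) = \<phi> k \<otimes>\<^bsub>H\<^esub> \<phi> (g j)"
      unfolding k(3) by (rule hom_mult[OF k(1) c(2)])
    then have "\<phi> (g i) = \<phi> (g j)" using c k(2) by simp
    with ne ij show False by blast
  qed
  ultimately show ?thesis
    unfolding discriminated_by_def using Q by blast
qed

end

theory Submission
  imports Defs
begin

text \<open>
  Write \<open>\<Delta>\<close> for the augmentation ideal of \<open>\<int>G\<close> and, for \<open>m \<ge> 1\<close> and a prime power \<open>q = p\<^sup>k\<close>, let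
  \<open>K\<^sub>m\<^sub>,\<^sub>q\<close> be the normal subgroup of all \<open>x\<close> with \<open>x - 1 \<in> \<Delta>\<^sup>m + q\<int>G\<close>. Two facts about these
  subgroups prove the theorem.

  First, \<open>G / K\<^sub>m\<^sub>,\<^sub>q\<close> is a nilpotent \<open>p\<close>-group of bounded exponent
  (\<open>in_class_K_congruence_quotient\<close>). The subgroups \<open>K\<^sub>i\<^sub>,\<^sub>q\<close> for \<open>i = 1, \<dots>, m\<close> form a central
  filtration, because \<open>xy - yx = (x - 1)(y - 1) - (y - 1)(x - 1)\<close> lies one step deeper than
  \<open>x - 1\<close>. Raising to the power \<open>q\<close> also moves one step down: \<open>x\<^sup>q - 1\<close> is \<open>x - 1\<close> times
  \<open>1 + x + \<dots> + x\<^bsup>q-1\<^esup>\<close>, and this factor has augmentation \<open>q\<close>, so it lies in \<open>\<Delta> + q\<int>G\<close>.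

  Second, an element \<open>c\<close> that lies in \<open>K\<^sub>m\<^sub>,\<^sub>q\<close> for every prime power \<open>q\<close> commutes modulo \<open>D\<^sub>m(G)\<close>
  with every \<open>d\<close> in the rational dimension subgroup \<open>D\<^sub>m\<^sub>,\<^sub>\<rat>(G)\<close>
  (\<open>residual_commutes_with_rational_dimension_subgroup\<close>). By the Chinese remainder theorem,
  \<open>c - 1 \<in> \<Delta>\<^sup>m + N\<int>G\<close> for every \<open>N > 0\<close>. Clearing denominators gives an \<open>N > 0\<close> with
  \<open>N(d - 1) \<in> \<Delta>\<^sup>m\<close>. Multiplying the two, the factor \<open>N\<close> is absorbed by \<open>d - 1\<close>, so
  \<open>(c - 1)(d - 1)\<close> and \<open>(d - 1)(c - 1)\<close> are in \<open>\<Delta>\<^sup>m\<close>, hence \<open>[c, d] \<in> D\<^sub>m(G)\<close>.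

  Now let \<open>c = [w\<^sub>1, \<dots>, w\<^sub>r]\<close> be one of the generators of \<open>W\<close>. If \<open>c\<close> survives in some
  \<open>G / K\<^sub>m\<^sub>,\<^sub>q\<close>, then so does every \<open>w\<^sub>i\<close>, since a commutator with one trivial entry is trivial.
  Up to inversion every \<open>g\<^sub>j\<^sup>-\<^sup>1g\<^sub>k\<close> is one of the \<open>w\<^sub>i\<close>, so the images of the \<open>g\<^sub>j\<close> in this quotient
  are distinct, which is (b). If no generator survives in any of the quotients, then for each
  generator \<open>c\<close> and each \<open>d \<in> D\<^sub>\<omega>\<^sub>,\<^sub>\<rat>(G)\<close> the second fact puts \<open>[c, d]\<close> into
  \<open>D\<^sub>\<omega>(G) = {1}\<close>, which is (a).
\<close>

section \<open>Scalars and change of coefficients in group rings\<close>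

lemma lookup_map_zero:
  "\<phi> 0 = 0 \<Longrightarrow> Poly_Mapping.lookup (Poly_Mapping.map \<phi> f) x = \<phi> (Poly_Mapping.lookup f x)"
  by (simp add: map.rep_eq when_def)

lemma map_zero [simp]: "Poly_Mapping.map \<phi> 0 = 0"
  by (rule poly_mapping_eqI) (simp add: map.rep_eq)

lemma keys_map_subset: "Poly_Mapping.keys (Poly_Mapping.map \<phi> f) \<subseteq> Poly_Mapping.keys f"
  by (auto simp: in_keys_iff map.rep_eq when_def)

text \<open>
  Multiplication by a scalar and the passage from \<open>\<int>G\<close> to \<open>\<rat>G\<close> both act on the coefficients,
  so \<^const>\<open>Poly_Mapping.map\<close> serves for both, and their laws can be read off coefficientwise.
\<close>

abbreviation scale :: "'r::comm_ring_1 \<Rightarrow> ('a \<Rightarrow>\<^sub>0 'r) \<Rightarrow> ('a \<Rightarrow>\<^sub>0 'r)" where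
  "scale q \<equiv> Poly_Mapping.map ((*) q)"

abbreviation rationalize :: "('a \<Rightarrow>\<^sub>0 int) \<Rightarrow> ('a \<Rightarrow>\<^sub>0 rat)" where
  "rationalize \<equiv> Poly_Mapping.map rat_of_int"

lemma lookup_scale [simp]:
  "Poly_Mapping.lookup (scale q f) x = q * Poly_Mapping.lookup f x"
  by (simp add: lookup_map_zero)

lemma lookup_rationalize [simp]:
  "Poly_Mapping.lookup (rationalize f) x = of_int (Poly_Mapping.lookup f x)"
  by (simp add: lookup_map_zero)

lemma scale_add: "scale q (f + h) = scale q f + scale q h"
  by (rule poly_mapping_eqI) (simp add: lookup_add distrib_left)

lemma scale_scale: "scale q (scale r f) = scale (q * r) f"
  by (rule poly_mapping_eqI) (simp add: mult.assoc)

lemma rationalize_add: "rationalize (f + h) = rationalize f + rationalize h"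
  by (rule poly_mapping_eqI) (simp add: lookup_add)

lemma rationalize_scale: "rationalize (scale q f) = scale (of_int q) (rationalize f)"
  by (rule poly_mapping_eqI) simp

lemma rationalize_inject: "rationalize f = rationalize h \<Longrightarrow> f = h"
  by (auto simp: poly_mapping_eq_iff fun_eq_iff)

lemma augmentation_rationalize: "augmentation (rationalize f) = of_int (augmentation f)"
  using keys_map_subset[of rat_of_int f]
  by (simp add: augmentation_superset[where S = "Poly_Mapping.keys f"])

lemma augmentation_scale: "augmentation (scale q f) = q * augmentation f"
  using keys_map_subset[of "(*) q" f]
  by (simp add: augmentation_superset[where S = "Poly_Mapping.keys f"] sum_distrib_left)

lemma augmentation_diff: "augmentation (f - h) = augmentation f - augmentation h"
  using augmentation_add[of "f - h" h] by simp

lemma map_single: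
  "\<phi> 0 = 0 \<Longrightarrow> Poly_Mapping.map \<phi> (Poly_Mapping.single a r) = Poly_Mapping.single a (\<phi> r)"
  by (rule poly_mapping_eqI) (simp add: lookup_map_zero lookup_single when_def)

lemma group_ring_mult_diff_left:
  "(f - f') \<otimes>\<^bsub>group_ring G\<^esub> h = f \<otimes>\<^bsub>group_ring G\<^esub> h - f' \<otimes>\<^bsub>group_ring G\<^esub> h"
  using group_ring_mult_add_left[where f = "f - f'" and f' = f' and h = h and G = G] by simp

lemma group_ring_mult_diff_right:
  "h \<otimes>\<^bsub>group_ring G\<^esub> (f - f') = h \<otimes>\<^bsub>group_ring G\<^esub> f - h \<otimes>\<^bsub>group_ring G\<^esub> f'"
  using group_ring_mult_add_right[where f = "f - f'" and f' = f' and h = h and G = G] by simp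

lemmas group_ring_mult_distribs =
  group_ring_mult_add_left group_ring_mult_add_right
  group_ring_mult_diff_left group_ring_mult_diff_right

text \<open>
  Scalars pass through products on both sides. This is where commutativity of the coefficients
  enters, and it lets an integer factor be moved from one group ring element to another.
\<close>

lemma scale_mult_left: "scale q f \<otimes>\<^bsub>group_ring G\<^esub> h = scale q (f \<otimes>\<^bsub>group_ring G\<^esub> h)"
  using subset_UNIV[of "Poly_Mapping.keys f"]
proof (induction f rule: poly_mapping_single_add_induct)
  case (single a r)
  show ?case
    using subset_UNIV[of "Poly_Mapping.keys h"]
    by (induction h rule: poly_mapping_single_add_induct)
      (simp_all add: map_single group_ring_mult_single_single group_ring_mult_zero_right
         group_ring_mult_add_right scale_add mult.assoc)
qed (simp_all add: group_ring_mult_zero_left group_ring_mult_add_left scale_add)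

lemma scale_mult_right: "f \<otimes>\<^bsub>group_ring G\<^esub> scale q h = scale q (f \<otimes>\<^bsub>group_ring G\<^esub> h)"
  using subset_UNIV[of "Poly_Mapping.keys f"]
proof (induction f rule: poly_mapping_single_add_induct)
  case (single a r)
  show ?case
    using subset_UNIV[of "Poly_Mapping.keys h"]
    by (induction h rule: poly_mapping_single_add_induct)
      (simp_all add: map_single group_ring_mult_single_single group_ring_mult_zero_right
         group_ring_mult_add_right scale_add mult.left_commute[of r q])
qed (simp_all add: group_ring_mult_zero_left group_ring_mult_add_left scale_add)

lemma rationalize_mult:
  "rationalize (f \<otimes>\<^bsub>group_ring G\<^esub> h) = rationalize f \<otimes>\<^bsub>group_ring G\<^esub> rationalize h"
  using subset_UNIV[of "Poly_Mapping.keys f"]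
proof (induction f rule: poly_mapping_single_add_induct)
  case (single a r)
  show ?case
    using subset_UNIV[of "Poly_Mapping.keys h"]
    by (induction h rule: poly_mapping_single_add_induct)
      (simp_all add: map_single group_ring_mult_single_single group_ring_mult_zero_right
         group_ring_mult_add_right rationalize_add)
qed (simp_all add: group_ring_mult_zero_left group_ring_mult_add_left rationalize_add)

lemma group_ring_carrier_iff: "f \<in> carrier (group_ring G) \<longleftrightarrow> Poly_Mapping.keys f \<subseteq> carrier G"
  by (simp add: group_ring_def)

lemma group_ring_carrier_map:
  "f \<in> carrier (group_ring G) \<Longrightarrow> Poly_Mapping.map \<phi> f \<in> carrier (group_ring G)"
  using keys_map_subset[of \<phi> f] by (auto simp: group_ring_carrier_iff)

lemma group_ring_carrier_add:
  "f \<in> carrier (group_ring G) \<Longrightarrow> h \<in> carrier (group_ring G) \<Longrightarrow> f + h \<in> carrier (group_ring G)"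
  using Poly_Mapping.keys_add[of f h] by (auto simp: group_ring_carrier_iff)

lemma group_ring_carrier_diff:
  "f \<in> carrier (group_ring G) \<Longrightarrow> h \<in> carrier (group_ring G) \<Longrightarrow> f - h \<in> carrier (group_ring G)"
  using keys_diff[of f h] by (auto simp: group_ring_carrier_iff)

lemma group_ring_carrier_single:
  "a \<in> carrier G \<Longrightarrow> Poly_Mapping.single a r \<in> carrier (group_ring G)"
  by (auto simp: group_ring_carrier_iff)

lemma group_ring_carrier_zero: "0 \<in> carrier (group_ring G)"
  by (simp add: group_ring_carrier_iff)

section \<open>Powers of the augmentation ideal modulo a scalar\<close>

definition augmentation_power :: "('a, 'b) monoid_scheme \<Rightarrow> nat \<Rightarrow> ('a \<Rightarrow>\<^sub>0 'r::comm_ring_1) set" where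
  "augmentation_power G n = augmentation_ideal G [^]\<^bsub>ideals_set (group_ring G)\<^esub> n"

lemma augmentation_power_0: "augmentation_power G 0 = carrier (group_ring G)"
  by (simp add: augmentation_power_def ideals_set_def nat_pow_def)

lemma augmentation_power_Suc:
  "augmentation_power G (Suc n) = augmentation_power G n \<cdot>\<^bsub>group_ring G\<^esub> augmentation_ideal G"
  by (simp add: augmentation_power_def ideals_set_def nat_pow_def)

text \<open>The normal subgroup \<open>G \<inter> (1 + I)\<close>. For \<open>I = \<Delta>\<^sup>n\<close> it is the dimension subgroup.\<close>

definition congruence_subgroup ::
    "('a, 'b) monoid_scheme \<Rightarrow> ('a \<Rightarrow>\<^sub>0 'r::comm_ring_1) set \<Rightarrow> 'a set" where
  "congruence_subgroup G I =
     {x \<in> carrier G. Poly_Mapping.single x 1 - Poly_Mapping.single \<one>\<^bsub>G\<^esub> 1 \<in> I}"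

lemma dimension_subgroup_eq:
  "dimension_subgroup TYPE('r::comm_ring_1) G n
     = congruence_subgroup G (augmentation_power G n :: ('a \<Rightarrow>\<^sub>0 'r) set)"
proof -
  have "s \<in> \<one>\<^bsub>group_ring G\<^esub> <+\<^bsub>group_ring G\<^esub> I \<longleftrightarrow> s - Poly_Mapping.single \<one>\<^bsub>G\<^esub> 1 \<in> I"
    for s :: "'a \<Rightarrow>\<^sub>0 'r" and I
    by (force simp: a_l_coset_def l_coset_def group_ring_def algebra_simps)
  then show ?thesis
    by (simp add: dimension_subgroup_def congruence_subgroup_def augmentation_power_def)
qed

text \<open>
  The ideal \<open>\<Delta>\<^sup>n + qRG\<close>. Reduction modulo \<open>q\<close> is what makes the corresponding quotients of \<open>G\<close>
  have bounded exponent.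
\<close>

definition congruence_ideal ::
    "('a, 'b) monoid_scheme \<Rightarrow> nat \<Rightarrow> 'r \<Rightarrow> ('a \<Rightarrow>\<^sub>0 'r::comm_ring_1) set" where
  "congruence_ideal G n q =
     {a + scale q b | a b. a \<in> augmentation_power G n \<and> b \<in> carrier (group_ring G)}"

context group
begin

abbreviation group_ring_times (infixl \<open>\<star>\<close> 70) where
  "f \<star> h \<equiv> f \<otimes>\<^bsub>group_ring G\<^esub> h"

abbreviation embed :: "'a \<Rightarrow> ('a \<Rightarrow>\<^sub>0 'r::comm_ring_1)" where
  "embed x \<equiv> Poly_Mapping.single x 1"

lemma group_ring_mult_closed:
  "f \<in> carrier (group_ring G) \<Longrightarrow> h \<in> carrier (group_ring G) \<Longrightarrow> f \<star> h \<in> carrier (group_ring G)"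
  using ring.ring_simprules(5)[OF ring_group_ring[OF is_group]] .

lemma scale_eq_mult:
  assumes "f \<in> carrier (group_ring G)"
  shows "Poly_Mapping.single \<one> q \<star> f = scale q f"
  using assms[unfolded group_ring_carrier_iff]
  by (induction f rule: poly_mapping_single_add_induct)
    (simp_all add: group_ring_mult_single_single map_single group_ring_mult_zero_right
      group_ring_mult_add_right scale_add)

lemma one_mult: "f \<in> carrier (group_ring G) \<Longrightarrow> embed \<one> \<star> f = f"
  by (simp add: scale_eq_mult poly_mapping_eq_iff fun_eq_iff)

text \<open>
  The closure properties of an ideal in terms of the operations on \<open>'a \<Rightarrow>\<^sub>0 'r\<close> instead of the
  record fields of the group ring, so that elements can be rearranged by additive arithmetic.
\<close>

lemma
  assumes "ideal I (group_ring G)"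
  shows ideal_subset: "f \<in> I \<Longrightarrow> f \<in> carrier (group_ring G)"
    and ideal_zero: "0 \<in> I"
    and ideal_add: "f \<in> I \<Longrightarrow> h \<in> I \<Longrightarrow> f + h \<in> I"
    and ideal_scale: "f \<in> I \<Longrightarrow> scale q f \<in> I"
    and ideal_diff: "f \<in> I \<Longrightarrow> h \<in> I \<Longrightarrow> f - h \<in> I"
    and ideal_lmult: "f \<in> I \<Longrightarrow> k \<in> carrier (group_ring G) \<Longrightarrow> k \<star> f \<in> I"
    and ideal_rmult: "f \<in> I \<Longrightarrow> k \<in> carrier (group_ring G) \<Longrightarrow> f \<star> k \<in> I"
proof -
  interpret ideal I "group_ring G" by fact
  have add: "f + h \<in> I" if "f \<in> I" "h \<in> I" for f h
    using additive_subgroup.a_closed[OF additive_subgroup_axioms that] by (simp add: group_ring_def)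
  have scale: "scale q f \<in> I" if "f \<in> I" for f q
    using I_l_closed[OF that, of "Poly_Mapping.single \<one> q"] Icarr[OF that]
    by (simp add: scale_eq_mult group_ring_carrier_single)
  have "f - h = f + scale (-1) h" for f h :: "'a \<Rightarrow>\<^sub>0 'c"
    by (rule poly_mapping_eqI) (simp add: lookup_add lookup_minus)
  then show "f \<in> I \<Longrightarrow> h \<in> I \<Longrightarrow> f - h \<in> I"
    using add scale by metis
  show "0 \<in> I"
    using additive_subgroup.zero_closed[OF additive_subgroup_axioms]
    by (simp add: group_ring_def)
  show "f \<in> I \<Longrightarrow> h \<in> I \<Longrightarrow> f + h \<in> I" "f \<in> I \<Longrightarrow> scale q f \<in> I"
    by (rule add scale; assumption)+
qed (use assms in \<open>simp_all add: ideal.Icarr ideal.I_l_closed ideal.I_r_closed\<close>)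


text \<open>
  Negatives are products with \<open>-1\<close>, so closure under multiplication takes care of them.
\<close>

lemma ideal_group_ringI:
  assumes sub: "\<And>f. f \<in> I \<Longrightarrow> f \<in> carrier (group_ring G)" and zero: "0 \<in> I"
    and add: "\<And>f h. f \<in> I \<Longrightarrow> h \<in> I \<Longrightarrow> f + h \<in> I"
    and lmult: "\<And>f k. f \<in> I \<Longrightarrow> k \<in> carrier (group_ring G) \<Longrightarrow> k \<star> f \<in> I"
    and rmult: "\<And>f k. f \<in> I \<Longrightarrow> k \<in> carrier (group_ring G) \<Longrightarrow> f \<star> k \<in> I"
  shows "ideal I (group_ring G :: ('a \<Rightarrow>\<^sub>0 'r::comm_ring_1) ring)"
proof -
  let ?R = "group_ring G :: ('a \<Rightarrow>\<^sub>0 'r) ring"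
  interpret R: ring ?R by (rule ring_group_ring[OF is_group])
  have "\<ominus>\<^bsub>?R\<^esub> f \<in> I" if f: "f \<in> I" for f
  proof -
    have "\<ominus>\<^bsub>?R\<^esub> f = \<ominus>\<^bsub>?R\<^esub> \<one>\<^bsub>?R\<^esub> \<otimes>\<^bsub>?R\<^esub> f"
      using sub[OF f] by (simp add: R.l_minus)
    then show ?thesis using lmult[OF f, of "\<ominus>\<^bsub>?R\<^esub> \<one>\<^bsub>?R\<^esub>"] by simp
  qed
  then have "subgroup I (add_monoid ?R)"
    using sub zero add
    by (intro R.add.subgroupI) (auto simp: a_inv_def, auto simp: group_ring_def)
  then show ?thesis
    using lmult rmult by (intro idealI R.ring_axioms) auto
qed

lemma ideal_augmentation_power: "ideal (augmentation_power G n) (group_ring G)"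
proof (induction n)
  case 0
  then show ?case
    by (simp add: augmentation_power_0 ring.oneideal ring_group_ring is_group)
next
  case (Suc n)
  then show ?case
    by (simp add: augmentation_power_Suc ring.ideal_prod_is_ideal ring_group_ring is_group
        ideal_augmentation_ideal)
qed

lemma augmentation_power_add:
  "augmentation_power G (i + j)
     = augmentation_power G i \<cdot>\<^bsub>group_ring G\<^esub> augmentation_power G j"
proof (induction j)
  case 0
  then show ?case
    by (simp add: augmentation_power_0 ring.ideal_prod_one ring_group_ring is_group
        ideal_augmentation_power)
next
  case (Suc j)
  then show ?case
    by (simp add: augmentation_power_Suc ring.ideal_prod_assoc ring_group_ring is_group
        ideal_augmentation_power ideal_augmentation_ideal)
qed

lemma augmentation_power_mult:
  assumes "f \<in> augmentation_power G i" "h \<in> augmentation_power G j"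
  shows "f \<star> h \<in> augmentation_power G (i + j)"
  unfolding augmentation_power_add using assms by (rule ideal_prod.prod)

lemma augmentation_ideal_subset_power: "f \<in> augmentation_ideal G \<Longrightarrow> f \<in> augmentation_power G 1"
  using ideal_prod.prod[of "embed \<one>" "augmentation_power G 0" f "augmentation_ideal G" "group_ring G"]
    one_mult[of f]
  by (simp add: augmentation_power_Suc augmentation_power_0 group_ring_carrier_single
      augmentation_ideal_def)

lemma embed_minus_one_in_augmentation_power:
  assumes "x \<in> carrier G"
  shows "embed x - embed \<one> \<in> augmentation_power G 1"
  using assms
  by (intro augmentation_ideal_subset_power)
     (simp add: augmentation_ideal_def augmentation_diff group_ring_carrier_diff group_ring_carrier_single)

lemma congruence_idealI:
  "\<lbrakk>a \<in> augmentation_power G n; b \<in> carrier (group_ring G); f = a + scale q b\<rbrakk>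
     \<Longrightarrow> f \<in> congruence_ideal G n q"
  by (auto simp: congruence_ideal_def)

lemma congruence_idealE:
  assumes "f \<in> congruence_ideal G n q"
  obtains a b where "f = a + scale q b" "a \<in> augmentation_power G n"
    "b \<in> carrier (group_ring G)" "a \<in> carrier (group_ring G)"
  using assms ideal_subset[OF ideal_augmentation_power] by (auto simp: congruence_ideal_def)

lemma ideal_congruence_ideal:
  fixes q :: "'r::comm_ring_1"
  shows "ideal (congruence_ideal G n q) (group_ring G)"
proof (rule ideal_group_ringI)
  note I = ideal_augmentation_power[of n]
  fix f assume "f \<in> congruence_ideal G n q"
  then obtain a b where f: "f = a + scale q b" and a: "a \<in> augmentation_power G n"
    and b: "b \<in> carrier (group_ring G)" and a': "a \<in> carrier (group_ring G)"
    by (rule congruence_idealE)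
  show "f \<in> carrier (group_ring G)"
    using a' b f by (simp add: group_ring_carrier_add group_ring_carrier_map)
  show "f + h \<in> congruence_ideal G n q" if "h \<in> congruence_ideal G n q" for h
  proof -
    from that obtain c d where h: "h = c + scale q d" and c: "c \<in> augmentation_power G n"
      and d: "d \<in> carrier (group_ring G)" by (rule congruence_idealE)
    show ?thesis
      by (rule congruence_idealI[of "a + c" _ "b + d"])
         (use a b c d in \<open>simp_all add: ideal_add[OF I] group_ring_carrier_add f h scale_add\<close>)
  qed
  fix k :: "'a \<Rightarrow>\<^sub>0 'r" assume k: "k \<in> carrier (group_ring G)"
  show "k \<star> f \<in> congruence_ideal G n q"
    by (rule congruence_idealI[of "k \<star> a" _ "k \<star> b"])
       (use a b k in \<open>simp_all add: ideal_lmult[OF I] group_ring_mult_closed f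
          group_ring_mult_add_right scale_mult_right\<close>)
  show "f \<star> k \<in> congruence_ideal G n q"
    by (rule congruence_idealI[of "a \<star> k" _ "b \<star> k"])
       (use a b k in \<open>simp_all add: ideal_rmult[OF I] group_ring_mult_closed f
          group_ring_mult_add_left scale_mult_left\<close>)
next
  show "0 \<in> congruence_ideal G n q"
    by (rule congruence_idealI[of 0 _ 0])
       (simp_all add: ideal_zero[OF ideal_augmentation_power] group_ring_carrier_zero)
qed

lemma augmentation_power_subset_congruence_ideal:
  "f \<in> augmentation_power G n \<Longrightarrow> f \<in> congruence_ideal G n q"
  by (rule congruence_idealI[of f _ 0]) (simp_all add: group_ring_carrier_zero)

text \<open>
  The ideals \<open>\<Delta>\<^sup>n + qRG\<close> with fixed \<open>q\<close> form a multiplicative filtration, as all the mixed terms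
  of a product carry a factor \<open>q\<close>.
\<close>

lemma congruence_ideal_mult:
  assumes f: "f \<in> congruence_ideal G i q" and h: "h \<in> congruence_ideal G j q"
  shows "f \<star> h \<in> congruence_ideal G (i + j) q"
proof -
  from f obtain a b where f: "f = a + scale q b" and a: "a \<in> augmentation_power G i"
    and b: "b \<in> carrier (group_ring G)" and a': "a \<in> carrier (group_ring G)"
    by (rule congruence_idealE)
  from h obtain c d where h: "h = c + scale q d" and c: "c \<in> augmentation_power G j"
    and d: "d \<in> carrier (group_ring G)" and c': "c \<in> carrier (group_ring G)"
    by (rule congruence_idealE)
  show ?thesis
    by (rule congruence_idealI[of "a \<star> c" _ "b \<star> c + a \<star> d + b \<star> scale q d"])
       (use augmentation_power_mult[OF a c] a' b c' d in \<open>simp_all add: f h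
          group_ring_mult_closed group_ring_carrier_add group_ring_carrier_map
          group_ring_mult_add_left group_ring_mult_add_right
          scale_mult_left scale_mult_right scale_add\<close>)
qed

section \<open>Congruence subgroups and commutators\<close>

text \<open>
  The elements congruent to \<open>1\<close> modulo a two-sided ideal form the kernel of the map from \<open>G\<close> to
  the units of the quotient ring. The proof expresses \<open>xy - 1\<close>, \<open>x\<^sup>-\<^sup>1 - 1\<close> and \<open>xhx\<^sup>-\<^sup>1 - 1\<close> through
  \<open>x - 1\<close>, \<open>y - 1\<close> and \<open>h - 1\<close>.
\<close>

lemma normal_congruence_subgroup:
  assumes I: "ideal I (group_ring G)"
  shows "congruence_subgroup G I \<lhd> G"
proof -
  let ?K = "congruence_subgroup G I"
  note simps = group_ring_mult_distribs group_ring_mult_single_single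
  note S = group_ring_carrier_single[where G = G]
  have "subgroup ?K G"
  proof (rule subgroupI)
    show "?K \<noteq> {}"
      using ideal_zero[OF I] by (auto simp: congruence_subgroup_def intro!: exI[of _ \<one>])
  next
    fix x assume "x \<in> ?K"
    then have x: "x \<in> carrier G" "embed x - embed \<one> \<in> I"
      by (auto simp: congruence_subgroup_def)
    have "embed (inv x) - embed \<one> = 0 - embed (inv x) \<star> (embed x - embed \<one>)"
      using x(1) by (simp add: simps)
    also have "\<dots> \<in> I"
      using x(1) by (intro ideal_diff[OF I ideal_zero[OF I] ideal_lmult[OF I x(2)]] S) auto
    finally show "inv x \<in> ?K"
      using x(1) by (simp add: congruence_subgroup_def)
    fix y assume "y \<in> ?K"
    then have y: "y \<in> carrier G" "embed y - embed \<one> \<in> I"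
      by (auto simp: congruence_subgroup_def)
    have "embed (x \<otimes> y) - embed \<one>
            = (embed x - embed \<one>) \<star> embed y + (embed y - embed \<one>)"
      using x(1) y(1) by (simp add: simps)
    also have "\<dots> \<in> I"
      using x y by (intro ideal_add[OF I] ideal_rmult[OF I] S) auto
    finally show "x \<otimes> y \<in> ?K"
      using x(1) y(1) by (simp add: congruence_subgroup_def)
  qed (auto simp: congruence_subgroup_def)
  moreover have "x \<otimes> h \<otimes> inv x \<in> ?K" if x: "x \<in> carrier G" and "h \<in> ?K" for x h
  proof -
    have h: "h \<in> carrier G" "embed h - embed \<one> \<in> I"
      using that by (auto simp: congruence_subgroup_def)
    have "embed (x \<otimes> h \<otimes> inv x) - embed \<one> = embed x \<star> (embed h - embed \<one>) \<star> embed (inv x)"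
      using x h(1) by (simp add: simps)
    also have "\<dots> \<in> I"
      using x h by (intro ideal_lmult[OF I] ideal_rmult[OF I] S) auto
    finally show ?thesis
      using x h(1) by (simp add: congruence_subgroup_def)
  qed
  ultimately show ?thesis by (simp add: normal_inv_iff)
qed

lemma group_commutator_closed:
  "x \<in> carrier G \<Longrightarrow> y \<in> carrier G \<Longrightarrow> group_commutator G x y \<in> carrier G"
  by (simp add: group_commutator_def)

lemma group_commutator_eq_one_iff:
  assumes "x \<in> carrier G" "y \<in> carrier G"
  shows "group_commutator G x y = \<one> \<longleftrightarrow> x \<otimes> y = y \<otimes> x"
proof -
  have "group_commutator G x y = inv (y \<otimes> x) \<otimes> (x \<otimes> y)"
    using assms by (simp add: group_commutator_def inv_mult_group m_assoc)
  then show ?thesis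
    using assms by (metis inv_equality inv_inv inv_closed m_closed l_inv)
qed

text \<open>
  Based on \<open>[x,y] - 1 = x\<^sup>-\<^sup>1y\<^sup>-\<^sup>1((x - 1)(y - 1) - (y - 1)(x - 1))\<close>. Both the nilpotency of the
  quotients and the centralizing property come down to this identity.
\<close>

lemma group_commutator_in_congruence_subgroup:
  assumes I: "ideal I (group_ring G)" and x: "x \<in> carrier G" and y: "y \<in> carrier G"
    and xy: "(embed x - embed \<one>) \<star> (embed y - embed \<one>) \<in> I"
    and yx: "(embed y - embed \<one>) \<star> (embed x - embed \<one>) \<in> I"
  shows "group_commutator G x y \<in> congruence_subgroup G I"
proof -
  have inv_cancel: "inv y \<otimes> (y \<otimes> x) = x"
    using x y by (simp flip: m_assoc)
  have "embed (group_commutator G x y) - embed \<one>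
          = embed (inv x \<otimes> inv y) \<star>
            ((embed x - embed \<one>) \<star> (embed y - embed \<one>)
               - (embed y - embed \<one>) \<star> (embed x - embed \<one>))"
    using x y inv_cancel
    by (simp add: group_ring_mult_distribs group_ring_mult_single_single group_commutator_def
        m_assoc)
  also have "\<dots> \<in> I"
    using x y by (intro ideal_lmult[OF I] ideal_diff[OF I xy yx] group_ring_carrier_single) auto
  finally show ?thesis
    using group_commutator_closed[OF x y] by (simp add: congruence_subgroup_def)
qed

lemma group_commutator_in_normal_subgroup:
  assumes "N \<lhd> G" "x \<in> carrier G" "y \<in> carrier G" "x \<in> N \<or> y \<in> N"
  shows "group_commutator G x y \<in> N"
proof -
  interpret N: normal N G by fact
  from assms(4) show ?thesis
  proof
    assume "x \<in> N"
    then have "inv x \<otimes> (inv y \<otimes> x \<otimes> y) \<in> N"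
      using N.inv_op_closed1[of y x] assms(3) by (intro N.m_closed[of "inv x"]) auto
    then show ?thesis using assms(2,3) by (simp add: group_commutator_def m_assoc)
  next
    assume "y \<in> N"
    then have "inv x \<otimes> inv y \<otimes> x \<otimes> y \<in> N"
      using N.inv_op_closed1[of x "inv y"] assms(2) by (intro N.m_closed[of _ y]) auto
    then show ?thesis by (simp add: group_commutator_def)
  qed
qed

lemma left_normed_commutator_closed:
  assumes "ws \<noteq> []" "set ws \<subseteq> carrier G"
  shows "left_normed_commutator G ws \<in> carrier G"
  using assms
proof (induction ws rule: rev_nonempty_induct)
  case (snoc w ws)
  then show ?case by (simp add: left_normed_commutator_snoc group_commutator_closed)
qed (simp add: left_normed_commutator_singleton)

lemma left_normed_commutator_in_normal_subgroup:
  assumes N: "N \<lhd> G" and "ws \<noteq> []" "set ws \<subseteq> carrier G" "w \<in> set ws" "w \<in> N"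
  shows "left_normed_commutator G ws \<in> N"
  using assms(2-)
proof (induction ws rule: rev_nonempty_induct)
  case (snoc v ws)
  then have "left_normed_commutator G ws \<in> carrier G"
    by (simp add: left_normed_commutator_closed)
  then show ?case
    using snoc group_commutator_in_normal_subgroup[OF N, of "left_normed_commutator G ws" v]
    by (auto simp: left_normed_commutator_snoc)
qed (simp add: left_normed_commutator_singleton)


section \<open>The quotients are nilpotent p-groups of bounded exponent\<close>

text \<open>
  A descending central filtration of \<open>G\<close> that reaches \<open>N\<close> bounds the lower central series of
  \<open>G / N\<close> term by term.
\<close>

lemma in_class_K_quotient:
  fixes F :: "nat \<Rightarrow> 'a set" and p :: nat
  assumes N: "N \<lhd> G" and p: "Factorial_Ring.prime p"
    and F: "\<And>i. subgroup (F i) G" and F0: "F 0 = carrier G" and Fc: "F c = N"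
    and comm: "\<And>i x y. x \<in> F i \<Longrightarrow> y \<in> carrier G \<Longrightarrow> group_commutator G x y \<in> F (Suc i)"
    and pow: "\<And>x. x \<in> carrier G \<Longrightarrow> x [^] p ^ e \<in> N"
  shows "in_class_K (G Mod N)"
proof -
  interpret N: normal N G by fact
  let ?Q = "G Mod N" and ?\<pi> = "\<lambda>x. N #> x"
  interpret Q: group ?Q by (rule N.factorgroup_is_group)
  interpret \<pi>: group_hom G ?Q ?\<pi>
    using N.r_coset_hom_Mod by unfold_locales
  have lcs: "lower_central_series ?Q i \<subseteq> ?\<pi> ` F i" for i
  proof (induction i)
    case 0
    show ?case by (simp add: F0 carrier_FactGroup)
  next
    case (Suc i)
    have "subgroup (?\<pi> ` F (Suc i)) ?Q"
      by (rule \<pi>.subgroup_img_is_subgroup[OF F])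
    moreover have "group_commutator ?Q A B \<in> ?\<pi> ` F (Suc i)"
      if A: "A \<in> lower_central_series ?Q i" and B: "B \<in> carrier ?Q" for A B
    proof -
      from A Suc obtain x where x: "x \<in> F i" "A = ?\<pi> x" by blast
      from B obtain y where y: "y \<in> carrier G" "B = ?\<pi> y" by (auto simp: carrier_FactGroup)
      have "x \<in> carrier G" using subgroup.subset[OF F] x(1) by blast
      then have "group_commutator ?Q A B = ?\<pi> (group_commutator G x y)"
        using y unfolding group_commutator_def x(2) y(2)
        by (simp only: \<pi>.hom_inv[symmetric] \<pi>.hom_mult[symmetric] m_closed inv_closed)
      then show ?thesis using comm[OF x(1) y(1)] by blast
    qed
    ultimately show ?case
      unfolding lower_central_series.simps by (intro Q.generate_subgroup_incl) blast+
  qed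
  have trivial: "?\<pi> x = \<one>\<^bsub>?Q\<^esub>" if "x \<in> N" for x
    using N.rcos_const[OF is_group that] by simp
  have "lower_central_series ?Q c \<subseteq> {\<one>\<^bsub>?Q\<^esub>}"
    using lcs[of c] trivial by (auto simp: Fc)
  then have nil: "nilpotent_group ?Q"
    using one_in_lower_central_series[OF Q.is_group, of c] Q.is_group
    by (auto simp: nilpotent_group_def intro!: exI[of _ c])
  have pow_Q: "A [^]\<^bsub>?Q\<^esub> (p ^ e) = \<one>\<^bsub>?Q\<^esub>" if "A \<in> carrier ?Q" for A
  proof -
    from that obtain x where x: "x \<in> carrier G" "A = ?\<pi> x" by (auto simp: carrier_FactGroup)
    have "?\<pi> (x [^] (p ^ e)) = A [^]\<^bsub>?Q\<^esub> (p ^ e)"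
      unfolding x(2) by (rule N.FactGroup_pow[OF x(1), symmetric])
    then show ?thesis using trivial[OF pow[OF x(1)]] by simp
  qed
  then have "\<exists>k. Q.ord A = p ^ k" if "A \<in> carrier ?Q" for A
    using that p Q.pow_eq_id[OF that, of "p ^ e"] divides_primepow_nat[of p "Q.ord A" e] by auto
  then have "p_group p ?Q"
    using Q.is_group by (simp add: p_group_def)
  moreover have "bounded_exponent ?Q"
    using pow_Q prime_gt_0_nat[OF p] by (auto simp: bounded_exponent_def intro!: exI[of _ "p ^ e"])
  ultimately show ?thesis
    using nil p by (auto simp: in_class_K_def nilpotent_p_group_bounded_def)
qed

text \<open>The factor \<open>s\<close> is the geometric sum \<open>1 + x + \<dots> + x\<^bsup>k-1\<^esup>\<close>.\<close>

lemma embed_pow_minus_one_factorization: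
  assumes x: "x \<in> carrier G"
  shows "\<exists>s \<in> carrier (group_ring G). augmentation s = (of_nat k :: 'r::comm_ring_1) \<and>
           embed (x [^] k) - embed \<one> = (embed x - embed \<one>) \<star> s"
proof (induction k)
  case 0
  show ?case
    by (rule bexI[of _ 0]) (simp_all add: group_ring_mult_zero_right group_ring_carrier_zero)
next
  case (Suc k)
  then obtain s :: "'a \<Rightarrow>\<^sub>0 'r" where s: "s \<in> carrier (group_ring G)" "augmentation s = of_nat k"
    "embed (x [^] k) - embed \<one> = (embed x - embed \<one>) \<star> s" by blast
  have "embed (x [^] Suc k) - embed \<one>
          = (embed x - embed \<one>) \<star> embed (x [^] k) + (embed (x [^] k) - (embed \<one> :: 'a \<Rightarrow>\<^sub>0 'r))"
    using x nat_pow_Suc2[OF x, of k]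
    by (simp add: group_ring_mult_diff_left group_ring_mult_single_single)
  also have "\<dots> = (embed x - embed \<one>) \<star> (embed (x [^] k) + s)"
    by (simp add: s group_ring_mult_add_right)
  finally show ?case
    using x s by (intro bexI[of _ "embed (x [^] k) + s"])
      (simp_all add: augmentation_add group_ring_carrier_add group_ring_carrier_single)
qed

text \<open>
  The geometric sum of length \<open>N\<close> has augmentation \<open>N\<close>, so it lies in \<open>\<Delta> + NRG\<close>, and multiplying
  \<open>x - 1\<close> by it gains one power of \<open>\<Delta>\<close>. This avoids the divisibility of binomial coefficients in
  the expansion of \<open>(1 + (x - 1))\<^sup>N\<close>.
\<close>

lemma pow_in_congruence_subgroup_Suc:
  fixes N :: nat
  assumes "x \<in> congruence_subgroup G (congruence_ideal G n (of_nat N :: 'r::comm_ring_1))"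
  shows "x [^] N \<in> congruence_subgroup G (congruence_ideal G (Suc n) (of_nat N :: 'r))"
proof -
  let ?q = "of_nat N :: 'r"
  have x: "x \<in> carrier G" "embed x - embed \<one> \<in> congruence_ideal G n ?q"
    using assms by (auto simp: congruence_subgroup_def)
  obtain s :: "'a \<Rightarrow>\<^sub>0 'r" where s: "s \<in> carrier (group_ring G)" "augmentation s = ?q"
    "embed (x [^] N) - embed \<one> = (embed x - embed \<one>) \<star> s"
    using embed_pow_minus_one_factorization[OF x(1)] by blast
  have "s - scale ?q (embed \<one>) \<in> augmentation_ideal G"
    using s by (simp add: augmentation_ideal_def augmentation_diff augmentation_scale
        group_ring_carrier_diff group_ring_carrier_map group_ring_carrier_single)
  then have "s \<in> congruence_ideal G 1 ?q"
    by (intro congruence_idealI[of "s - scale ?q (embed \<one>)" _ "embed \<one>"]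
          augmentation_ideal_subset_power)
       (simp_all add: group_ring_carrier_single)
  from congruence_ideal_mult[OF x(2) this] show ?thesis
    using x(1) by (simp add: congruence_subgroup_def s(3))
qed

text \<open>
  The filtration starts at \<open>\<Delta> + qRG\<close>, whose congruence subgroup is all of \<open>G\<close>, and ends at
  \<open>\<Delta>\<^sup>m\<^sup>+\<^sup>1 + qRG\<close>; each of the \<open>m\<close> steps costs a power of \<open>q = p\<^sup>k\<close>, so the exponent
  of the quotient divides \<open>p\<^sup>k\<^sup>m\<close>.
\<close>

lemma in_class_K_congruence_quotient:
  assumes p: "Factorial_Ring.prime p"
  shows "in_class_K (G Mod congruence_subgroup G (congruence_ideal G (Suc m) (of_nat (p ^ k) :: 'r::comm_ring_1)))"
proof -
  let ?q = "of_nat (p ^ k) :: 'r"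
  define J where "J n = congruence_ideal G n ?q" for n
  define F where "F i = congruence_subgroup G (J (Suc i))" for i
  have J: "ideal (J n) (group_ring G)" for n
    unfolding J_def by (rule ideal_congruence_ideal)
  have J1: "embed x - embed \<one> \<in> J 1" if "x \<in> carrier G" for x
    unfolding J_def
    by (intro augmentation_power_subset_congruence_ideal embed_minus_one_in_augmentation_power that)
  have F0: "F 0 = carrier G"
    using J1 by (auto simp: F_def congruence_subgroup_def)
  have normal: "F i \<lhd> G" for i
    unfolding F_def by (rule normal_congruence_subgroup[OF J])
  have comm: "group_commutator G x y \<in> F (Suc i)" if "x \<in> F i" and y: "y \<in> carrier G" for i x y
  proof -
    have x: "x \<in> carrier G" "embed x - embed \<one> \<in> J (Suc i)"
      using that by (auto simp: F_def congruence_subgroup_def)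
    show ?thesis
      unfolding F_def
    proof (rule group_commutator_in_congruence_subgroup[OF J x(1) y])
      show "(embed x - embed \<one>) \<star> (embed y - embed \<one>) \<in> J (Suc (Suc i))"
        using congruence_ideal_mult[OF x(2)[unfolded J_def] J1[OF y, unfolded J_def]]
        by (simp add: J_def)
      show "(embed y - embed \<one>) \<star> (embed x - embed \<one>) \<in> J (Suc (Suc i))"
        using congruence_ideal_mult[OF J1[OF y, unfolded J_def] x(2)[unfolded J_def]]
        by (simp add: J_def)
    qed
  qed
  have pow: "x [^] p ^ (k * i) \<in> F i" if x: "x \<in> carrier G" for x i
  proof (induction i)
    case 0
    show ?case using x by (simp add: F0)
  next
    case (Suc i)
    then have "(x [^] p ^ (k * i)) [^] p ^ k \<in> F (Suc i)"
      unfolding F_def J_def by (rule pow_in_congruence_subgroup_Suc)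
    then show ?case
      using x by (simp add: nat_pow_pow power_add mult.commute)
  qed
  have "in_class_K (G Mod F m)"
    by (rule in_class_K_quotient[OF normal p normal_imp_subgroup[OF normal] F0 refl comm pow])
  then show ?thesis by (simp add: F_def J_def)
qed

section \<open>Elements surviving in no quotient centralize the rational dimension subgroups\<close>

text \<open>
  Denominators can be cleared inside \<open>\<Delta>\<^sub>\<rat>\<^sup>n\<close>: its elements are finite sums of products of elements
  of augmentation \<open>0\<close>, and clearing the denominators of a factor does not change that its
  augmentation vanishes.
\<close>

lemma integral_multiple_in_augmentation_power:
  assumes "f \<in> augmentation_power G n"
  shows "\<exists>N>0. \<exists>h \<in> augmentation_power G n. scale (rat_of_int N) f = rationalize h"
proof -
  have clear: "\<exists>N>0. \<exists>h \<in> carrier (group_ring G). scale (rat_of_int N) f = rationalize h"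
    if "f \<in> carrier (group_ring G)" for f
    using that[unfolded group_ring_carrier_iff]
  proof (induction f rule: poly_mapping_single_add_induct)
    case zero
    show ?case
      by (intro exI[of _ 1] conjI bexI[of _ 0]) (simp_all add: group_ring_carrier_zero)
  next
    case (single a r)
    obtain u v where "quotient_of r = (u, v)" by fastforce
    then have "v > 0" "r = of_int u / of_int v"
      using quotient_of_denom_pos quotient_of_div by blast+
    then show ?case
      using single
      by (intro exI[of _ v] conjI bexI[of _ "Poly_Mapping.single a u"])
         (simp_all add: map_single group_ring_carrier_single)
  next
    case (add f f')
    then obtain N h N' h' where *: "N > 0" "h \<in> carrier (group_ring G)" "scale (rat_of_int N) f = rationalize h"
      "N' > 0" "h' \<in> carrier (group_ring G)" "scale (rat_of_int N') f' = rationalize h'" by blast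
    have "scale (rat_of_int (N * N')) (f + f') = rationalize (scale N' h + scale N h')"
      by (simp add: rationalize_add rationalize_scale scale_add scale_scale mult.commute
          flip: *(3,6))
    then show ?case
      using * by (intro exI[of _ "N * N'"] conjI bexI[of _ "scale N' h + scale N h'"])
        (simp_all add: group_ring_carrier_add group_ring_carrier_map)
  qed
  show ?thesis using assms
  proof (induction n arbitrary: f)
    case 0
    then show ?case using clear by (simp add: augmentation_power_0)
  next
    case (Suc n)
    note I = ideal_augmentation_power[of "Suc n"]
    from Suc.prems show ?case
      unfolding augmentation_power_Suc[of G n, where 'b = rat]
    proof (induction rule: ideal_prod.induct)
      case (prod f f')
      from Suc.IH[OF prod(1)] obtain N h where
        h: "N > 0" "h \<in> augmentation_power G n" "scale (rat_of_int N) f = rationalize h" by blast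
      from prod(2) clear[of f'] obtain N' h' where
        h': "N' > 0" "h' \<in> carrier (group_ring G)" "scale (rat_of_int N') f' = rationalize h'"
        by (auto simp: augmentation_ideal_def)
      have "rat_of_int (augmentation h') = 0"
        using prod(2) by (simp add: augmentation_scale augmentation_ideal_def
            flip: augmentation_rationalize h'(3))
      then have "h' \<in> augmentation_ideal G"
        using h'(2) by (simp add: augmentation_ideal_def)
      then have "h \<star> h' \<in> augmentation_power G (Suc n)"
        unfolding augmentation_power_Suc using h(2) by (intro ideal_prod.prod)
      moreover have "scale (rat_of_int (N * N')) (f \<star> f') = rationalize (h \<star> h')"
        by (simp add: rationalize_mult scale_mult_left scale_mult_right scale_scale mult.commute
            flip: h(3) h'(3))
      ultimately show ?case
        using h(1) h'(1) by (intro exI[of _ "N * N'"]) auto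
    next
      case (sum f f')
      then obtain N h N' h' where *: "N > 0" "h \<in> augmentation_power G (Suc n)"
        "scale (rat_of_int N) f = rationalize h"
        "N' > 0" "h' \<in> augmentation_power G (Suc n)" "scale (rat_of_int N') f' = rationalize h'"
        by blast
      have "scale (rat_of_int (N * N')) (f + f') = rationalize (scale N' h + scale N h')"
        by (simp add: rationalize_add rationalize_scale scale_add scale_scale mult.commute
            flip: *(3,6))
      then show ?case
        using * by (intro exI[of _ "N * N'"] conjI bexI[of _ "scale N' h + scale N h'"])
          (simp_all add: ideal_add[OF I] ideal_scale[OF I] group_ring_def)
    qed
  qed
qed

text \<open>
  If \<open>f = a + qb = c + rd\<close>, then \<open>f = uqf + vrf = uq(c + rd) + vr(a + qb)\<close>, and every term without a
  factor \<open>qr\<close> is a multiple of \<open>a\<close> or \<open>c\<close>.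
\<close>

lemma congruence_ideal_coprime_mult:
  assumes f: "f \<in> congruence_ideal G n q" "f \<in> congruence_ideal G n r"
    and bezout: "u * q + v * r = 1"
  shows "f \<in> congruence_ideal G n (q * r)"
proof -
  note I = ideal_augmentation_power[of n]
  from f(1) obtain a b where ab: "f = a + scale q b" "a \<in> augmentation_power G n"
    "b \<in> carrier (group_ring G)" by (rule congruence_idealE)
  from f(2) obtain c d where cd: "f = c + scale r d" "c \<in> augmentation_power G n"
    "d \<in> carrier (group_ring G)" by (rule congruence_idealE)
  have "f = scale (u * q) f + scale (v * r) f"
    by (rule poly_mapping_eqI) (simp add: lookup_add bezout flip: distrib_right)
  also have "\<dots> = scale (u * q) (c + scale r d) + scale (v * r) (a + scale q b)"
    using ab(1) cd(1) by simp
  also have "\<dots> = (scale (u * q) c + scale (v * r) a) + scale (q * r) (scale u d + scale v b)"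
    by (rule poly_mapping_eqI) (simp add: lookup_add algebra_simps)
  finally show ?thesis
    using ab(2,3) cd(2,3)
    by (elim congruence_idealI[rotated 2])
       (simp_all add: ideal_add[OF I] ideal_scale[OF I] group_ring_carrier_add group_ring_carrier_map)
qed

text \<open>The Chinese remainder theorem in additive form, by splitting off one prime at a time.\<close>

lemma congruence_ideal_of_prime_powers:
  fixes N :: nat
  assumes f: "f \<in> carrier (group_ring G)" and "N > 0"
    and pp: "\<And>p k. Factorial_Ring.prime p \<Longrightarrow> f \<in> congruence_ideal G n (int (p ^ k))"
  shows "f \<in> congruence_ideal G n (int N)"
  using \<open>N > 0\<close>
proof (induction N rule: less_induct)
  case (less N)
  show ?case
  proof (cases "N = 1")
    case True
    have "scale 1 f = f" by (rule poly_mapping_eqI) simp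
    then show ?thesis
      using True f
      by (intro congruence_idealI[of 0 _ f]) (simp_all add: ideal_zero[OF ideal_augmentation_power])
  next
    case False
    then obtain p where p: "Factorial_Ring.prime p" "p dvd N"
      using prime_factor_nat by blast
    then obtain M where M: "N = p ^ multiplicity p N * M" "\<not> p dvd M"
      using multiplicity_decompose'[of N p] less.prems by (auto simp: prime_nat_iff)
    \<comment> \<open>The whole \<open>p\<close>-part has to be split off, so that the cofactor \<open>M\<close> is coprime to it.\<close>
    let ?q = "p ^ multiplicity p N"
    have "multiplicity p N > 0"
      using p less.prems by (simp add: prime_multiplicity_gt_zero_iff)
    then have "?q > 1" using prime_gt_1_nat[OF p(1)] by (intro one_less_power)
    moreover have "M > 0" using M(2) by (cases M) auto
    ultimately have "M < N" by (subst M(1)) simp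
    have "coprime ?q M"
      using p(1) M(2) by (simp add: prime_imp_coprime)
    then have "coprime (int ?q) (int M)" by (simp only: coprime_int_iff)
    then obtain u v where "u * int ?q + v * int M = 1"
      by (metis bezout_int coprime_imp_gcd_eq_1)
    from congruence_ideal_coprime_mult[OF pp[OF p(1)] less.IH[OF \<open>M < N\<close> \<open>M > 0\<close>] this]
    show ?thesis by (subst M(1)) simp
  qed
qed

text \<open>
  For \<open>f = a + qb\<close> the factor \<open>q\<close> moves over to \<open>h\<close>, as in \<open>fh = ah + b(qh)\<close>: divisible elements
  annihilate torsion elements.
\<close>

lemma congruence_mult_torsion:
  assumes f: "f \<in> congruence_ideal G n q" and h: "h \<in> carrier (group_ring G)"
    and qh: "scale q h \<in> augmentation_power G n"
  shows "f \<star> h \<in> augmentation_power G n" "h \<star> f \<in> augmentation_power G n"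
proof -
  note I = ideal_augmentation_power[of n]
  from f obtain a b where ab: "f = a + scale q b" "a \<in> augmentation_power G n"
    "b \<in> carrier (group_ring G)" by (rule congruence_idealE)
  have "f \<star> h = a \<star> h + b \<star> scale q h" "h \<star> f = h \<star> a + scale q h \<star> b"
    by (simp_all add: ab(1) group_ring_mult_add_left group_ring_mult_add_right
        scale_mult_left scale_mult_right)
  then show "f \<star> h \<in> augmentation_power G n" "h \<star> f \<in> augmentation_power G n"
    using ab(2,3) h qh by (simp_all add: ideal_add[OF I] ideal_lmult[OF I] ideal_rmult[OF I])
qed

text \<open>
  In the additive group of \<open>\<int>G\<close> modulo \<open>\<Delta>\<^sup>n\<close>, the class of \<open>c - 1\<close> is divisible by every positive
  integer and that of \<open>d - 1\<close> is torsion, so both of their products vanish.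
\<close>

lemma residual_commutes_with_rational_dimension_subgroup:
  assumes c: "c \<in> carrier G" and d: "d \<in> dimension_subgroup TYPE(rat) G n"
    and res: "\<And>p k. Factorial_Ring.prime p \<Longrightarrow>
                c \<in> congruence_subgroup G (congruence_ideal G n (int (p ^ k)))"
  shows "group_commutator G c d \<in> dimension_subgroup TYPE(int) G n"
proof -
  have d': "d \<in> carrier G" "embed d - embed \<one> \<in> (augmentation_power G n :: ('a \<Rightarrow>\<^sub>0 rat) set)"
    using d by (auto simp: dimension_subgroup_eq congruence_subgroup_def)
  from integral_multiple_in_augmentation_power[OF d'(2)] obtain N h where
    N: "N > 0" "h \<in> augmentation_power G n"
      "scale (rat_of_int N) (embed d - embed \<one>) = rationalize h" by blast
  have "rationalize (scale N (embed d - embed \<one>)) = rationalize h"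
    unfolding N(3)[symmetric]
    by (rule poly_mapping_eqI) (simp add: lookup_minus lookup_single when_def)
  from rationalize_inject[OF this] have Nd: "scale N (embed d - embed \<one>) \<in> augmentation_power G n"
    using N(2) by simp
  have "embed c - embed \<one> \<in> congruence_ideal G n (int (nat N))"
  proof (rule congruence_ideal_of_prime_powers)
    show "embed c - embed \<one> \<in> carrier (group_ring G)"
      using c by (simp add: group_ring_carrier_diff group_ring_carrier_single)
    show "nat N > 0" using N(1) by simp
    show "embed c - embed \<one> \<in> congruence_ideal G n (int (p ^ k))"
      if "Factorial_Ring.prime p" for p k
      using res[OF that] unfolding congruence_subgroup_def by blast
  qed
  then have cN: "embed c - embed \<one> \<in> congruence_ideal G n N"
    using N(1) by simp
  have "embed d - embed \<one> \<in> carrier (group_ring G)"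
    using d'(1) by (simp add: group_ring_carrier_diff group_ring_carrier_single)
  from congruence_mult_torsion[OF cN this Nd] show ?thesis
    unfolding dimension_subgroup_eq
    by (rule group_commutator_in_congruence_subgroup[OF ideal_augmentation_power c d'(1)])
qed

section \<open>Centralizing or discriminating\<close>

lemma subgroup_group_centralizer:
  assumes "S \<subseteq> carrier G"
  shows "subgroup (group_centralizer G S) G"
proof (rule subgroupI)
  show "group_centralizer G S \<noteq> {}"
    using assms by (auto simp: group_centralizer_def intro!: exI[of _ \<one>])
next
  fix a assume "a \<in> group_centralizer G S"
  then have a: "a \<in> carrier G" "\<And>s. s \<in> S \<Longrightarrow> a \<otimes> s = s \<otimes> a"
    by (auto simp: group_centralizer_def)
  have "inv a \<otimes> s = s \<otimes> inv a" if "s \<in> S" for s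
  proof -
    have s: "s \<in> carrier G" using that assms by blast
    have "inv a \<otimes> s = inv a \<otimes> (s \<otimes> a) \<otimes> inv a"
      using a(1) s by (simp add: m_assoc)
    also have "\<dots> = s \<otimes> inv a"
      using a(1) s by (simp add: a(2)[OF that, symmetric] flip: m_assoc)
    finally show ?thesis .
  qed
  then show "inv a \<in> group_centralizer G S"
    using a(1) by (simp add: group_centralizer_def)
  fix b assume "b \<in> group_centralizer G S"
  then have b: "b \<in> carrier G" "\<And>s. s \<in> S \<Longrightarrow> b \<otimes> s = s \<otimes> b"
    by (auto simp: group_centralizer_def)
  have "a \<otimes> b \<otimes> s = s \<otimes> (a \<otimes> b)" if "s \<in> S" for s
    using a b that assms by (metis m_assoc subsetD)
  then show "a \<otimes> b \<in> group_centralizer G S"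
    using a(1) b(1) by (simp add: group_centralizer_def)
qed (auto simp: group_centralizer_def)

text \<open>
  If two of the elements coincide modulo \<open>N\<close>, then both of their quotients lie in \<open>N\<close>; one of them
  is an entry of the commutator, which is therefore in \<open>N\<close> as well.
\<close>

lemma discriminated_by_quotient:
  assumes N: "N \<lhd> G" and K: "K (G Mod N)" and g: "g \<in> {1..n} \<rightarrow> carrier G"
    and ws: "ws \<noteq> []" "set ws \<subseteq> carrier G"
    and cover: "\<forall>j\<in>{1..n}. \<forall>k\<in>{1..n}. j \<noteq> k \<longrightarrow>
       inv (g j) \<otimes> g k \<in> set ws \<or> inv (g k) \<otimes> g j \<in> set ws"
    and c: "left_normed_commutator G ws \<notin> N"
  shows "discriminated_by K G g n"
proof -
  interpret N: normal N G by fact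
  have "N #> g j \<noteq> N #> g k" if jk: "j \<in> {1..n}" "k \<in> {1..n}" "j \<noteq> k" for j k
  proof
    assume eq: "N #> g j = N #> g k"
    have gc: "g j \<in> carrier G" "g k \<in> carrier G" using g jk by auto
    have lr: "inv (g i) \<otimes> g l \<in> N"
      if "N #> g i = N #> g l" "g i \<in> carrier G" "g l \<in> carrier G" for i l
    proof -
      have "g l \<in> g i <# N"
        using that rcos_self[OF that(3) N.is_subgroup] N.coset_eq by auto
      then obtain h where "h \<in> N" "g l = g i \<otimes> h" by (auto simp: l_coset_def)
      then show ?thesis using that(2) by (simp flip: m_assoc)
    qed
    have "\<exists>w\<in>set ws. w \<in> N"
      using cover jk lr[OF eq gc] lr[OF eq[symmetric] gc(2,1)] by blast
    then show False
      using left_normed_commutator_in_normal_subgroup[OF N ws] c by blast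
  qed
  then show ?thesis
    unfolding discriminated_by_def
    using K N.factorgroup_is_group N.r_coset_hom_Mod by blast
qed

end

theorem theorem16:
  fixes G :: "('a, 'b) monoid_scheme" and g :: "nat \<Rightarrow> 'a" and n :: nat
  assumes "group G"
    and "dimension_subgroup_omega TYPE(rat) G \<noteq> {\<one>\<^bsub>G\<^esub>}"
    and "dimension_subgroup_omega TYPE(int) G = {\<one>\<^bsub>G\<^esub>}"
    and "g \<in> {1..n} \<rightarrow> carrier G"
    and "inj_on g {1..n}"
  shows "difference_commutator_subgroup G g n
           \<subseteq> group_centralizer G (dimension_subgroup_omega TYPE(rat) G)
         \<or> discriminated_by (in_class_K :: 'a set monoid \<Rightarrow> bool) G g n"
proof (rule disjCI)
  interpret group G by fact
  let ?D = "dimension_subgroup_omega TYPE(rat) G"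
  let ?K = "\<lambda>m p k. congruence_subgroup G (congruence_ideal G m (int (p ^ k)))"
  assume not_disc: "\<not> discriminated_by (in_class_K :: 'a set monoid \<Rightarrow> bool) G g n"
  have D: "?D \<subseteq> carrier G"
    by (force simp: dimension_subgroup_omega_def dimension_subgroup_def)
  have central: "left_normed_commutator G ws \<in> group_centralizer G ?D"
    if ws: "ws \<noteq> []" "set ws \<subseteq> carrier G"
      and cover: "\<forall>j\<in>{1..n}. \<forall>k\<in>{1..n}. j \<noteq> k \<longrightarrow>
        inv\<^bsub>G\<^esub> (g j) \<otimes>\<^bsub>G\<^esub> g k \<in> set ws \<or> inv\<^bsub>G\<^esub> (g k) \<otimes>\<^bsub>G\<^esub> g j \<in> set ws" for ws
  proof -
    let ?c = "left_normed_commutator G ws"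
    have c: "?c \<in> carrier G" by (rule left_normed_commutator_closed[OF ws])
    have res: "?c \<in> ?K (Suc m) p k" if "Factorial_Ring.prime p" for m p k
    proof (rule ccontr)
      assume c_notin: "?c \<notin> ?K (Suc m) p k"
      have "discriminated_by (in_class_K :: 'a set monoid \<Rightarrow> bool) G g n"
        by (rule discriminated_by_quotient[where N = "?K (Suc m) p k" and K = in_class_K and ws = ws,
              OF normal_congruence_subgroup[OF ideal_congruence_ideal]
                in_class_K_congruence_quotient[OF that] assms(4) ws cover c_notin])
      with not_disc show False ..
    qed
    have "?c \<otimes>\<^bsub>G\<^esub> d = d \<otimes>\<^bsub>G\<^esub> ?c" if d: "d \<in> ?D" for d
    proof -
      have "group_commutator G ?c d \<in> dimension_subgroup TYPE(int) G m" if "m \<in> {1..}" for m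
      proof -
        \<comment> \<open>\<open>D\<^sub>\<omega>\<close> is an intersection over positive indices, and the quotients are indexed by successors.\<close>
        from that obtain m' where m': "m = Suc m'" by (cases m) auto
        show ?thesis
          unfolding m'
          by (rule residual_commutes_with_rational_dimension_subgroup[OF c _ res])
             (use d in \<open>auto simp: dimension_subgroup_omega_def\<close>)
      qed
      then have "group_commutator G ?c d = \<one>\<^bsub>G\<^esub>"
        using assms(3) by (auto simp: dimension_subgroup_omega_def)
      then show ?thesis
        using group_commutator_eq_one_iff c d D by blast
    qed
    then show ?thesis using c by (simp add: group_centralizer_def)
  qed
  have differences: "{inv\<^bsub>G\<^esub> (g j) \<otimes>\<^bsub>G\<^esub> g k | j k. j \<in> {1..n} \<and> k \<in> {1..n} \<and> j \<noteq> k} \<subseteq> carrier G"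
    using funcset_mem[OF assms(4)] by (blast intro: m_closed inv_closed)
  show "difference_commutator_subgroup G g n \<subseteq> group_centralizer G ?D"
    unfolding difference_commutator_subgroup_def
  proof (rule generate_subgroup_incl[OF _ subgroup_group_centralizer[OF D]], rule subsetI, elim CollectE exE conjE)
    fix c ws
    assume ws: "c = left_normed_commutator G ws" "ws \<noteq> []"
      "set ws \<subseteq> {inv\<^bsub>G\<^esub> (g j) \<otimes>\<^bsub>G\<^esub> g k | j k. j \<in> {1..n} \<and> k \<in> {1..n} \<and> j \<noteq> k}"
      "\<forall>j\<in>{1..n}. \<forall>k\<in>{1..n}. j \<noteq> k \<longrightarrow>
        inv\<^bsub>G\<^esub> (g j) \<otimes>\<^bsub>G\<^esub> g k \<in> set ws \<or> inv\<^bsub>G\<^esub> (g k) \<otimes>\<^bsub>G\<^esub> g j \<in> set ws"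
    show "c \<in> group_centralizer G ?D"
      unfolding ws(1)
      by (rule central[OF ws(2) subset_trans[OF ws(3) differences] ws(4)])
  qed
qed

end
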